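(* Let $G=((A,B),E_G)$ be a connected bipartite graph with partite sets $A$ and $B$ such that $1\le |A|\le |B|$. Then the following statements are equivalent: (1) $\gamma(G)=|A|$. (2) $\gamma(G)=\beta(G)=|A|$. (3) $G$ has the following two properties: (a) Each support vertex of $G$ belonging to $B$ is a weak support, and each of its non-leaf neighbors is a support vertex of $G$. (b) If $x$ and $y$ are vertices belonging to $A-(L_G\cup S_G)$ and $d_G(x,y)=2$, then there are at least two (distinct) vertices $\overline{x}$ and $\overline{y}$ in $B$ such that $N_G(\overline{x})=N_G(\overline{y})=\{x,y\}$.
   Context: Graphs are finite, simple and undirected. $N_G(v)$ is the set of neighbors of $v$; $d_G$ is the graph distance. A leaf is a vertex of degree one; a support vertex (support) is a vertex adjacent to at least one leaf; a weak support is a vertex adjacent to exactly one leaf. $L_G$ and $S_G$ denote the sets of leaves and of support vertices of $G$, respectively. A set $D\subseteq V_G$ is dominating if every vertex in $V_G-D$ has a neighbor in $D$; $\gamma(G)$ is the minimum cardinality of a dominating set. A set $C\subseteq V_G$ is a covering set if every edge of $G$ has at least one end-vertex in $C$; $\beta(G)$ is the minimum cardinality of a covering set. *)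

theory Defs
  imports "Graph_Theory.Graph_Theory"
begin

text \<open>
  A finite simple undirected graph is an instance of the locale \<^locale>\<open>graph\<close>: a finite symmetric
  digraph without loops and parallel arcs. An undirected edge is a pair of opposite arcs, so the
  degree of a vertex is its out-degree.
\<close>

definition neighbors :: "('a, 'b) pre_digraph \<Rightarrow> 'a \<Rightarrow> 'a set" where
  "neighbors G v = {w. v \<rightarrow>\<^bsub>G\<^esub> w}"

definition leaves :: "('a, 'b) pre_digraph \<Rightarrow> 'a set" where
  "leaves G = {v \<in> verts G. out_degree G v = 1}"

definition supports :: "('a, 'b) pre_digraph \<Rightarrow> 'a set" where
  "supports G = {v \<in> verts G. \<exists>l \<in> leaves G. v \<rightarrow>\<^bsub>G\<^esub> l}"

definition weak_supports :: "('a, 'b) pre_digraph \<Rightarrow> 'a set" where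
  "weak_supports G = {v \<in> verts G. \<exists>!l. l \<in> leaves G \<and> v \<rightarrow>\<^bsub>G\<^esub> l}"

text \<open>The distance is the infimum of the lengths of all walks, in the extended reals.\<close>

definition graph_dist :: "('a, 'b) pre_digraph \<Rightarrow> 'a \<Rightarrow> 'a \<Rightarrow> ereal" where
  "graph_dist G u v = wf_digraph.\<mu> G (\<lambda>_. 1) u v"

definition dominating_set :: "('a, 'b) pre_digraph \<Rightarrow> 'a set \<Rightarrow> bool" where
  "dominating_set G D \<longleftrightarrow> D \<subseteq> verts G \<and> (\<forall>v \<in> verts G - D. \<exists>w \<in> D. v \<rightarrow>\<^bsub>G\<^esub> w)"

definition covering_set :: "('a, 'b) pre_digraph \<Rightarrow> 'a set \<Rightarrow> bool" where
  "covering_set G C \<longleftrightarrow> C \<subseteq> verts G \<and> (\<forall>e \<in> arcs G. tail G e \<in> C \<or> head G e \<in> C)"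

definition domination_number :: "('a, 'b) pre_digraph \<Rightarrow> nat" where
  "domination_number G = Min {card D | D. dominating_set G D}"

definition covering_number :: "('a, 'b) pre_digraph \<Rightarrow> nat" where
  "covering_number G = Min {card C | C. covering_set G C}"

definition bipartition :: "('a, 'b) pre_digraph \<Rightarrow> 'a set \<Rightarrow> 'a set \<Rightarrow> bool" where
  "bipartition G A B \<longleftrightarrow> A \<union> B = verts G \<and> A \<inter> B = {} \<and>
     (\<forall>e \<in> arcs G. tail G e \<in> A \<and> head G e \<in> B \<or> tail G e \<in> B \<and> head G e \<in> A)"

end

theory Submission
  imports Defs
begin

text \<open>
  The partite set \<open>A\<close> is always dominating and covering, and covering sets dominate, so (1) and (2)
  are equivalent. If (3) fails, then two vertices of \<open>A\<close> can be exchanged for a single vertex of \<open>B\<close>,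
  giving a dominating set of size \<open>|A| - 1\<close>. If (3) holds and \<open>D\<close> is dominating, then \<open>A - D\<close> injects
  into \<open>B \<inter> D\<close>, whence \<open>|D| \<ge> |A|\<close>: a support vertex is sent to one of its leaves, any other leaf to
  its support, and two remaining vertices of \<open>A - D\<close> with a common neighbor have two private common
  neighbors, which must belong to \<open>D\<close>.
\<close>

text \<open>As a default elimination rule it splits every adjacency into arcs, on which \<open>blast\<close> diverges.\<close>
declare reachableE [rule del]

section \<open>Adjacency, leaves and supports\<close>

context graph
begin

lemma adj_sym: "u \<rightarrow>\<^bsub>G\<^esub> v \<Longrightarrow> v \<rightarrow>\<^bsub>G\<^esub> u"
  using arcs_ends_symmetric[OF sym_arcs] .

lemma in_neighbors_iff [simp]: "w \<in> neighbors G v \<longleftrightarrow> v \<rightarrow>\<^bsub>G\<^esub> w"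
  by (simp add: neighbors_def)

text \<open>Without parallel arcs, \<open>head G\<close> is injective on the out-arcs of
  \<open>v\<close>, so the out-degree counts neighbors.\<close>

lemma leaves_iff: "v \<in> leaves G \<longleftrightarrow> (\<exists>w. neighbors G v = {w})"
proof -
  have img: "neighbors G v = head G ` out_arcs G v"
    by (auto simp: neighbors_def arcs_ends_conv out_arcs_def image_iff)
  have "inj_on (head G) (out_arcs G v)"
    by (rule inj_onI) (auto simp: arc_to_ends_def intro: no_multi_arcs)
  then have "out_degree G v = card (neighbors G v)"
    by (simp add: img out_degree_def card_image)
  moreover have "v \<in> verts G" if "neighbors G v = {w}" for w
    using that adj_in_verts(1)[of v w] in_neighbors_iff by blast
  ultimately show ?thesis
    by (auto simp: leaves_def card_1_singleton_iff)
qed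

lemma leaf_neighbor_unique: "\<lbrakk>l \<in> leaves G; l \<rightarrow>\<^bsub>G\<^esub> u; l \<rightarrow>\<^bsub>G\<^esub> v\<rbrakk> \<Longrightarrow> u = v"
  by (metis leaves_iff in_neighbors_iff singletonD)

lemma supportsI: "\<lbrakk>s \<rightarrow>\<^bsub>G\<^esub> l; l \<in> leaves G\<rbrakk> \<Longrightarrow> s \<in> supports G"
  unfolding supports_def using adj_in_verts(1) by fast

section \<open>Walk lengths, distance two and connectedness\<close>

lemma awalk_cost_unit: "awalk_cost (\<lambda>_. 1) p = real (length p)"
  by (induction p) auto

lemma graph_dist_less:
  assumes "graph_dist G u v < ereal c"
  obtains p where "awalk u p v" "real (length p) < c"
  using assms that by (auto simp: graph_dist_def \<mu>_def INF_less_iff awalk_cost_unit)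

lemma graph_dist_le_length: "awalk u p v \<Longrightarrow> graph_dist G u v \<le> ereal (length p)"
  using min_cost_le_walk_cost[of u p v "\<lambda>_. 1"] by (simp add: graph_dist_def awalk_cost_unit)

lemma graph_dist_eq_2_iff:
  "graph_dist G u v = 2 \<longleftrightarrow> u \<noteq> v \<and> \<not> u \<rightarrow>\<^bsub>G\<^esub> v \<and> (\<exists>w. u \<rightarrow>\<^bsub>G\<^esub> w \<and> w \<rightarrow>\<^bsub>G\<^esub> v)" (is "?L \<longleftrightarrow> ?R")
proof
  assume L: ?L
  have ge: "length p \<ge> 2" if "awalk u p v" for p
    using graph_dist_le_length[OF that] L
    by (simp add: numeral_eq_ereal)
  \<comment> \<open>Any bound above 2 and at most 3 works: lengths are integers, so together with
    \<open>ge\<close> the walk has length exactly 2.\<close>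
  obtain p where p: "awalk u p v" "real (length p) < 3"
    by (rule graph_dist_less[of u v 3]) (use L in \<open>auto simp: numeral_eq_ereal\<close>)
  with ge[of p] have "length p = 2"
    by simp
  then obtain e f where "p = [e, f]"
    by (auto simp: numeral_2_eq_2 length_Suc_conv)
  with p have "u \<rightarrow>\<^bsub>G\<^esub> head G e" "head G e \<rightarrow>\<^bsub>G\<^esub> v"
    using in_arcs_imp_in_arcs_ends[of e] in_arcs_imp_in_arcs_ends[of f]
    by (auto simp: awalk_simps)
  moreover have "u \<noteq> v"
    using ge[of "[]"] p by (auto simp: awalk_Nil_iff)
  moreover have "\<not> u \<rightarrow>\<^bsub>G\<^esub> v"
  proof
    assume "u \<rightarrow>\<^bsub>G\<^esub> v"
    then obtain a where "a \<in> arcs G" "tail G a = u" "head G a = v"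
      by (rule reachableE)
    then have "awalk u [a] v"
      by (auto simp: awalk_simps)
    then show False
      using ge[of "[a]"] by simp
  qed
  ultimately show ?R
    by blast
next
  assume R: ?R
  then obtain w where "u \<rightarrow>\<^bsub>G\<^esub> w" "w \<rightarrow>\<^bsub>G\<^esub> v"
    by blast
  obtain e where "e \<in> arcs G" "tail G e = u" "head G e = w"
    using \<open>u \<rightarrow>\<^bsub>G\<^esub> w\<close> by (rule reachableE)
  moreover obtain f where "f \<in> arcs G" "tail G f = w" "head G f = v"
    using \<open>w \<rightarrow>\<^bsub>G\<^esub> v\<close> by (rule reachableE)
  ultimately have "awalk u [e, f] v"
    by (auto simp: awalk_simps)
  then have le: "graph_dist G u v \<le> 2"
    using graph_dist_le_length[of u "[e, f]" v] by (simp add: numeral_eq_ereal)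
  have "\<not> graph_dist G u v < 2"
  proof
    assume "graph_dist G u v < 2"
    then have "graph_dist G u v < ereal 2"
      by (simp add: numeral_eq_ereal)
    then obtain p where p: "awalk u p v" "real (length p) < 2"
      by (rule graph_dist_less)
    then consider "p = []" | a where "p = [a]"
      by (cases p; cases "tl p") auto
    then show False
    proof cases
      case 1
      then show False
        using p R by (simp add: awalk_Nil_iff)
    next
      case 2
      then have "u \<rightarrow>\<^bsub>G\<^esub> v"
        using p by (auto simp: awalk_simps intro: in_arcs_imp_in_arcs_ends)
      then show False
        using R by blast
    qed
  qed
  with le show ?L
    by simp
qed

text \<open>A symmetric connected digraph is strongly connected, and a path to a different vertex
  has a first step.\<close>

lemma connected_has_neighbor:
  assumes "connected G" "u \<in> verts G" "v \<in> verts G" "u \<noteq> v"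
  obtains w where "u \<rightarrow>\<^bsub>G\<^esub> w"
proof -
  have "u \<rightarrow>\<^sup>* v"
    using symmetric_connected_imp_strongly_connected[OF sym_arcs assms(1)] assms
    by (auto simp: strongly_connected_def)
  then show thesis
    using assms(4) that by (metis converse_reachable_cases)
qed

section \<open>Minimum cardinalities of vertex sets\<close>

context
  fixes P :: "'a set \<Rightarrow> bool" and Y :: "'a set"
  assumes sub_verts: "\<And>X. P X \<Longrightarrow> X \<subseteq> verts G" and Y: "P Y"
begin

text \<open>\<open>P\<close> stands for \<open>dominating_set G\<close> or
  \<open>covering_set G\<close>; the member \<open>Y\<close> makes the family nonempty, so that
  \<open>Min\<close> is attained.\<close>

lemma finite_card_vertex_sets: "finite {card X | X. P X}"
proof (rule finite_subset)
  show "{card X | X. P X} \<subseteq> card ` Pow (verts G)"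
    using sub_verts by auto
qed simp

lemma Min_card_vertex_sets_le: "Min {card X | X. P X} \<le> card Y"
  using Y by (intro Min_le finite_card_vertex_sets) blast

lemma Min_card_vertex_setsE:
  obtains X where "P X" "card X = Min {card X | X. P X}"
proof -
  have "Min {card X | X. P X} \<in> {card X | X. P X}"
    using Y by (intro Min_in finite_card_vertex_sets) blast
  then show thesis
    using that by auto
qed

end

lemma domination_number_le: "dominating_set G D \<Longrightarrow> domination_number G \<le> card D"
  unfolding domination_number_def
  by (rule Min_card_vertex_sets_le) (simp_all add: dominating_set_def)

lemma domination_numberE:
  obtains D where "dominating_set G D" "card D = domination_number G"
  unfolding domination_number_def
  by (rule Min_card_vertex_setsE[of "dominating_set G" "verts G"]) (simp_all add: dominating_set_def)

lemma covering_number_le: "covering_set G C \<Longrightarrow> covering_number G \<le> card C"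
  unfolding covering_number_def
  by (rule Min_card_vertex_sets_le) (simp_all add: covering_set_def)

lemma covering_numberE:
  obtains C where "covering_set G C" "card C = covering_number G"
  unfolding covering_number_def
  by (rule Min_card_vertex_setsE[of "covering_set G" "verts G"]) (simp_all add: covering_set_def)

end

section \<open>Bipartite graphs; equivalence of (1) and (2)\<close>

text \<open>\<open>no_isolated\<close> is the form in which connectedness enters the
  arguments.\<close>

locale bipartite_graph = graph G for G :: "('a, 'b) pre_digraph" (structure) +
  fixes A B :: "'a set"
  assumes bipartition: "bipartition G A B"
    and no_isolated: "v \<in> verts G \<Longrightarrow> \<exists>w. v \<rightarrow>\<^bsub>G\<^esub> w"
begin

lemma verts_eq: "verts G = A \<union> B"
  and disjoint: "a \<in> A \<Longrightarrow> a \<notin> B"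
  using bipartition unfolding bipartition_def by auto

lemma finite_A: "finite A"
  using finite_verts unfolding verts_eq by simp

lemma adj_bipartite: "u \<rightarrow>\<^bsub>G\<^esub> v \<Longrightarrow> u \<in> A \<and> v \<in> B \<or> u \<in> B \<and> v \<in> A"
  using bipartition unfolding bipartition_def by (auto elim: reachableE)

lemma adj_A: "\<lbrakk>u \<rightarrow>\<^bsub>G\<^esub> v; u \<in> A\<rbrakk> \<Longrightarrow> v \<in> B"
  and adj_B: "\<lbrakk>u \<rightarrow>\<^bsub>G\<^esub> v; u \<in> B\<rbrakk> \<Longrightarrow> v \<in> A"
  using adj_bipartite disjoint by blast+

text \<open>A vertex outside \<open>C\<close> lies on some edge, whose other end must then be in
  \<open>C\<close>.\<close>

lemma covering_imp_dominating:
  assumes "covering_set G C"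
  shows "dominating_set G C"
  unfolding dominating_set_def
proof (intro conjI ballI)
  show "C \<subseteq> verts G"
    using assms by (simp add: covering_set_def)
next
  fix v assume v: "v \<in> verts G - C"
  then obtain w where "v \<rightarrow>\<^bsub>G\<^esub> w"
    using no_isolated by blast
  moreover from this have "w \<in> C"
    using assms v unfolding covering_set_def by (auto elim: reachableE)
  ultimately show "\<exists>w \<in> C. v \<rightarrow>\<^bsub>G\<^esub> w"
    by blast
qed

lemma covering_A: "covering_set G A"
  using bipartition by (auto simp: covering_set_def bipartition_def)

lemma domination_eq_iff_domination_covering_eq:
  "domination_number G = card A \<longleftrightarrow>
     domination_number G = covering_number G \<and> covering_number G = card A"
proof -
  obtain C where C: "covering_set G C" "card C = covering_number G"
    by (rule covering_numberE)
  then have "domination_number G \<le> covering_number G"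
    using domination_number_le[OF covering_imp_dominating[OF C(1)]] by simp
  then show ?thesis
    using covering_number_le[OF covering_A] by linarith
qed

section \<open>Exchange arguments: (1) implies (3)\<close>

text \<open>In \<open>A - {x, y}\<close> together with \<open>z\<close>, the vertex \<open>z\<close>
  dominates \<open>x\<close> and \<open>y\<close>, while \<open>other\<close> leaves every further
  vertex of \<open>B\<close> a neighbor in \<open>A - {x, y}\<close>.\<close>

lemma exchange_two:
  assumes "x \<in> A" "y \<in> A" "x \<noteq> y" "z \<in> B" "z \<rightarrow>\<^bsub>G\<^esub> x" "z \<rightarrow>\<^bsub>G\<^esub> y"
    and other: "\<And>b. \<lbrakk>b \<in> B; b \<noteq> z\<rbrakk> \<Longrightarrow> \<not> neighbors G b \<subseteq> {x, y}"
  shows "domination_number G < card A"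
proof -
  let ?D = "insert z (A - {x, y})"
  have "dominating_set G ?D"
    unfolding dominating_set_def
  proof (intro conjI ballI)
    show "?D \<subseteq> verts G"
      using assms verts_eq by auto
  next
    fix v assume v: "v \<in> verts G - ?D"
    show "\<exists>w \<in> ?D. v \<rightarrow>\<^bsub>G\<^esub> w"
    proof (cases "v \<in> B")
      case True
      then obtain w where "w \<in> neighbors G v" "w \<notin> {x, y}"
        using other[of v] v by blast
      moreover from this have "w \<in> A"
        using adj_B True by simp
      ultimately show ?thesis
        by auto
    next
      case False
      then have "v = x \<or> v = y"
        using v verts_eq by auto
      then show ?thesis
        using assms adj_sym by blast
    qed
  qed
  then have "domination_number G \<le> card ?D"
    by (rule domination_number_le)
  also have "\<dots> = Suc (card (A - {x, y}))"
    using assms(4) disjoint finite_A by (subst card_insert_disjoint) auto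
  \<comment> \<open>\<open>card_mono\<close> supplies \<open>2 \<le> card A\<close>, which keeps the
    truncated subtraction exact.\<close>
  also have "\<dots> < card A"
    using card_Diff_subset[of "{x, y}" A] card_mono[OF finite_A, of "{x, y}"] assms(1-3) by simp
  finally show ?thesis .
qed

text \<open>Two leaves at \<open>s\<close> could be exchanged for \<open>s\<close>: their only
  neighbor is \<open>s\<close>, so any other vertex of \<open>B\<close> has its neighbors
  elsewhere.\<close>

lemma support_in_B_weak:
  assumes "domination_number G = card A" "s \<in> supports G" "s \<in> B"
  shows "s \<in> weak_supports G"
proof -
  obtain l where l: "l \<in> leaves G" "s \<rightarrow>\<^bsub>G\<^esub> l"
    using assms by (auto simp: supports_def)
  have "l' = l" if l': "l' \<in> leaves G" "s \<rightarrow>\<^bsub>G\<^esub> l'" for l'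
  proof (rule ccontr)
    assume "l' \<noteq> l"
    have "\<not> neighbors G b \<subseteq> {l', l}" if b: "b \<in> B" "b \<noteq> s" for b
    proof
      assume sub: "neighbors G b \<subseteq> {l', l}"
      obtain w where "b \<rightarrow>\<^bsub>G\<^esub> w"
        using no_isolated b verts_eq by blast
      with sub have "w \<in> leaves G" "w \<rightarrow>\<^bsub>G\<^esub> s" "w \<rightarrow>\<^bsub>G\<^esub> b"
        using l l' adj_sym by (auto simp: subset_iff)
      then show False
        using leaf_neighbor_unique b by blast
    qed
    then have "domination_number G < card A"
      using exchange_two[of l' l s] l l' \<open>l' \<noteq> l\<close> assms(3) adj_B by blast
    then show False
      using assms(1) by simp
  qed
  then show ?thesis
    using l assms(2) by (auto simp: weak_supports_def supports_def)
qed

text \<open>Otherwise \<open>w\<close> and a leaf \<open>l\<close> at \<open>s\<close> could be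
  exchanged for \<open>s\<close>: another vertex of \<open>B\<close> with neighbors only in
  \<open>{w, l}\<close> misses \<open>l\<close>, so it would be a leaf at \<open>w\<close>.\<close>

lemma support_in_B_neighbor:
  assumes "domination_number G = card A" "s \<in> supports G" "s \<in> B"
    and "s \<rightarrow>\<^bsub>G\<^esub> w" "w \<notin> leaves G"
  shows "w \<in> supports G"
proof (rule ccontr)
  assume w: "w \<notin> supports G"
  obtain l where l: "l \<in> leaves G" "s \<rightarrow>\<^bsub>G\<^esub> l"
    using assms by (auto simp: supports_def)
  have "\<not> neighbors G b \<subseteq> {w, l}" if b: "b \<in> B" "b \<noteq> s" for b
  proof
    assume sub: "neighbors G b \<subseteq> {w, l}"
    have "\<not> b \<rightarrow>\<^bsub>G\<^esub> l"
      using leaf_neighbor_unique l adj_sym b by blast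
    moreover obtain v where "b \<rightarrow>\<^bsub>G\<^esub> v"
      using no_isolated b verts_eq by blast
    ultimately have "neighbors G b = {w}"
      using sub by (auto simp: subset_iff)
    then have "b \<in> leaves G" "b \<rightarrow>\<^bsub>G\<^esub> w"
      using leaves_iff in_neighbors_iff by blast+
    then show False
      using w supportsI adj_sym by blast
  qed
  moreover have "w \<noteq> l"
    using l assms by blast
  ultimately have "domination_number G < card A"
    using exchange_two[of w l s] l assms adj_B by blast
  then show False
    using assms(1) by simp
qed

text \<open>A vertex of \<open>B\<close> with neighbors only in \<open>{x, y}\<close> is adjacent to
  both, since a leaf would make \<open>x\<close> or \<open>y\<close> a support. If at most one such
  vertex exists, an exchange is possible.\<close>

lemma two_private_common_neighbors:
  assumes "domination_number G = card A"
    and "x \<in> A" "x \<notin> supports G" "y \<in> A" "y \<notin> supports G" "x \<noteq> y" "z \<rightarrow>\<^bsub>G\<^esub> x" "z \<rightarrow>\<^bsub>G\<^esub> y"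
  shows "\<exists>x' \<in> B. \<exists>y' \<in> B. x' \<noteq> y' \<and> neighbors G x' = {x, y} \<and> neighbors G y' = {x, y}"
proof (rule ccontr)
  assume none: "\<not> ?thesis"
  \<comment> \<open>The vertex with neighborhood \<open>{x, y}\<close> is chosen if there is one, as
    it would lose all its neighbors in the exchange; otherwise any common neighbor serves.\<close>
  obtain z' where z': "z' \<rightarrow>\<^bsub>G\<^esub> x" "z' \<rightarrow>\<^bsub>G\<^esub> y"
    and unique: "\<And>b. \<lbrakk>b \<in> B; neighbors G b = {x, y}\<rbrakk> \<Longrightarrow> b = z'"
  proof (cases "\<exists>b \<in> B. neighbors G b = {x, y}")
    case True
    then obtain b where b: "b \<in> B" "neighbors G b = {x, y}"
      by blast
    then show thesis
      using that[of b] none in_neighbors_iff by blast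
  next
    case False
    then show thesis
      using that[of z] assms by blast
  qed
  have "\<not> neighbors G b \<subseteq> {x, y}" if b: "b \<in> B" "b \<noteq> z'" for b
  proof
    assume sub: "neighbors G b \<subseteq> {x, y}"
    have "neighbors G b \<noteq> {}"
      using no_isolated b verts_eq in_neighbors_iff by blast
    moreover have "neighbors G b \<noteq> {v}" if "v \<notin> supports G" for v
      using that leaves_iff supportsI adj_sym by (metis in_neighbors_iff singletonI)
    then have "neighbors G b \<noteq> {x}" "neighbors G b \<noteq> {y}"
      using assms by auto
    ultimately have "neighbors G b = {x, y}"
      using sub by blast
    then show False
      using unique b by blast
  qed
  then have "domination_number G < card A"
    using exchange_two[of x y z'] assms z' adj_A adj_sym by blast
  then show False
    using assms(1) by simp
qed

section \<open>An injection from \<open>A - D\<close> into \<open>D \<inter> B\<close>: (3) implies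
  (1)\<close>

lemma card_A_le_dominating:
  assumes supports_B: "\<And>s. \<lbrakk>s \<in> supports G; s \<in> B\<rbrakk> \<Longrightarrow> s \<in> weak_supports G \<and>
        (\<forall>w \<in> neighbors G s - leaves G. w \<in> supports G)"
    and private_pair: "\<And>x y z. \<lbrakk>x \<in> A - (leaves G \<union> supports G); y \<in> A - (leaves G \<union> supports G);
        x \<noteq> y; x \<rightarrow>\<^bsub>G\<^esub> z; z \<rightarrow>\<^bsub>G\<^esub> y\<rbrakk> \<Longrightarrow>
        \<exists>x' \<in> B. \<exists>y' \<in> B. x' \<noteq> y' \<and> neighbors G x' = {x, y} \<and> neighbors G y' = {x, y}"
    and D: "dominating_set G D"
  shows "card A \<le> card D"
proof -
  have D_verts: "D \<subseteq> A \<union> B"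
    and dom: "\<And>v. \<lbrakk>v \<in> A \<union> B; v \<notin> D\<rbrakk> \<Longrightarrow> \<exists>w \<in> D. v \<rightarrow>\<^bsub>G\<^esub> w"
    using D verts_eq unfolding dominating_set_def by auto
  \<comment> \<open>\<open>R\<close> collects the undominating vertices of \<open>A\<close> to which
    \<open>private_pair\<close> can apply; for \<open>x\<close> in \<open>R\<close>,
    \<open>close x y\<close> provides the pair.\<close>
  define R where "R = A - D - (leaves G \<union> supports G)"
  define close where "close x y \<longleftrightarrow> y \<in> R \<and> x \<noteq> y \<and> (\<exists>z. x \<rightarrow>\<^bsub>G\<^esub> z \<and> z \<rightarrow>\<^bsub>G\<^esub> y)" for x y
  define partner where "partner x = (SOME y. close x y)" for x
  define good where
    "good h e \<longleftrightarrow> inj_on h e \<and> (\<forall>v \<in> e. h v \<in> D \<and> neighbors G (h v) = e)" for h e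
  \<comment> \<open>Indexing the choice by the set \<open>{x, y}\<close> makes it agree for a pair of mutual partners.\<close>
  define g where "g e = (SOME h. good h e)" for e
  have good: "good (g {x, y}) {x, y}" if "x \<in> R" "close x y" for x y
  proof -
    obtain z where "x \<rightarrow>\<^bsub>G\<^esub> z" "z \<rightarrow>\<^bsub>G\<^esub> y"
      using \<open>close x y\<close> unfolding close_def by blast
    moreover have "x \<in> A - (leaves G \<union> supports G)" "y \<in> A - (leaves G \<union> supports G)" "x \<noteq> y"
      using that unfolding R_def close_def by auto
    ultimately obtain x' y' where xy': "x' \<in> B" "y' \<in> B" "x' \<noteq> y'"
        "neighbors G x' = {x, y}" "neighbors G y' = {x, y}"
      using private_pair by meson
    \<comment> \<open>Outside \<open>D\<close>, \<open>b\<close> would have to be dominated by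
      \<open>x\<close> or \<open>y\<close>, but both lie outside \<open>D\<close>.\<close>
    have "b \<in> D" if b: "b \<in> B" "neighbors G b = {x, y}" for b
    proof (rule ccontr)
      assume "b \<notin> D"
      then obtain w where "w \<in> D" "w \<in> neighbors G b"
        using dom[of b] b(1) by auto
      then show False
        using b(2) \<open>x \<in> R\<close> \<open>close x y\<close> by (auto simp: R_def close_def)
    qed
    then have "x' \<in> D" "y' \<in> D"
      using xy' by auto
    then have "good (\<lambda>v. if v = x then x' else y') {x, y}"
      using xy' that by (auto simp: good_def inj_on_def close_def)
    then show ?thesis
      unfolding g_def by (rule someI[where P = "\<lambda>h. good h {x, y}"])
  qed
  then have g: "\<And>x y. \<lbrakk>x \<in> R; close x y\<rbrakk> \<Longrightarrow> inj_on (g {x, y}) {x, y} \<and>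
      (\<forall>v \<in> {x, y}. g {x, y} v \<in> D \<and> neighbors G (g {x, y} v) = {x, y})"
    unfolding good_def by blast
  have partner: "close x (partner x)" if "close x y" for x y
    using that unfolding partner_def by (rule someI)
  \<comment> \<open>The clauses never conflict, as \<open>R\<close> contains no supports. A vertex
    covered by neither clause, such as a leaf that is not a support, may take any neighbor in
    \<open>D\<close>.\<close>
  have "\<exists>b \<in> D. v \<rightarrow>\<^bsub>G\<^esub> b \<and> (v \<in> supports G \<longrightarrow> b \<in> leaves G) \<and>
      (\<forall>y. v \<in> R \<and> close v y \<longrightarrow> b = g {v, partner v} v)" if v: "v \<in> A - D" for v
  proof -
    consider "v \<in> supports G" | y where "v \<in> R" "close v y" | "v \<notin> supports G" "\<forall>y. v \<in> R \<longrightarrow> \<not> close v y"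
      by blast
    then show ?thesis
    proof cases
      case 1
      then obtain l where l: "l \<in> leaves G" "v \<rightarrow>\<^bsub>G\<^esub> l"
        by (auto simp: supports_def)
      \<comment> \<open>The only neighbor of \<open>l\<close> is \<open>v\<close>, which is not in
        \<open>D\<close>, so \<open>l\<close> must dominate itself.\<close>
      have "l \<in> D"
        using dom[of l] leaf_neighbor_unique[of l v] l v adj_A[of v l] adj_sym by blast
      then show ?thesis
        using l 1 by (auto simp: R_def)
    next
      case 2
      note * = g[OF 2(1) partner[OF 2(2)]]
      then have "g {v, partner v} v \<rightarrow>\<^bsub>G\<^esub> v"
        using in_neighbors_iff by blast
      then show ?thesis
        using * 2 adj_sym by (auto simp: R_def)
    next
      case 3
      then show ?thesis
        using dom[of v] v by blast
    qed
  qed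
  then obtain F where F: "\<And>v. v \<in> A - D \<Longrightarrow> F v \<in> D" "\<And>v. v \<in> A - D \<Longrightarrow> v \<rightarrow>\<^bsub>G\<^esub> F v"
      "\<And>v. \<lbrakk>v \<in> A - D; v \<in> supports G\<rbrakk> \<Longrightarrow> F v \<in> leaves G"
      "\<And>v y. \<lbrakk>v \<in> A - D; v \<in> R; close v y\<rbrakk> \<Longrightarrow> F v = g {v, partner v} v"
    by metis
  have "inj_on F (A - D)"
  proof (rule inj_onI, rule ccontr)
    fix x y
    assume x: "x \<in> A - D" and y: "y \<in> A - D" and eq: "F x = F y" and "x \<noteq> y"
    have adj: "F x \<rightarrow>\<^bsub>G\<^esub> x" "F x \<rightarrow>\<^bsub>G\<^esub> y"
      using F(2)[OF x] F(2)[OF y] eq adj_sym by auto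
    \<comment> \<open>\<open>F x\<close> has the two neighbors \<open>x\<close> and
      \<open>y\<close>, whereas supports are sent to leaves.\<close>
    have "F x \<notin> leaves G"
      using leaf_neighbor_unique adj \<open>x \<noteq> y\<close> by blast
    then have not_supp: "x \<notin> supports G" "y \<notin> supports G"
      using F(3)[OF x] F(3)[OF y] eq by auto
    have "F x \<in> B"
      using F(2)[OF x] x adj_A by blast
    \<comment> \<open>If one were a leaf, \<open>F x\<close> would be a support in \<open>B\<close>;
      its non-leaf neighbors are supports, so both would be leaves, against weakness.\<close>
    have "x \<notin> leaves G \<and> y \<notin> leaves G"
    proof (rule ccontr)
      assume "\<not> (x \<notin> leaves G \<and> y \<notin> leaves G)"
      then have "F x \<in> supports G"
        using adj supportsI by blast
      then have "F x \<in> weak_supports G" "x \<in> leaves G" "y \<in> leaves G"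
        using supports_B[of "F x"] \<open>F x \<in> B\<close> not_supp adj by auto
      then show False
        using adj \<open>x \<noteq> y\<close> by (auto simp: weak_supports_def)
    qed
    then have R: "x \<in> R" "y \<in> R"
      using x y not_supp by (auto simp: R_def)
    then have close: "close x y" "close y x"
      using adj adj_sym \<open>x \<noteq> y\<close> unfolding close_def by blast+
    note gx = g[OF R(1) partner[OF close(1)]] and gy = g[OF R(2) partner[OF close(2)]]
    have eqs: "F x = g {x, partner x} x" "F x = g {y, partner y} y"
      using F(4)[OF x R(1) close(1)] F(4)[OF y R(2) close(2)] eq by auto
    \<comment> \<open>The neighborhood of \<open>F x\<close> equals both pairs. Hence the same
      function \<open>g {x, partner x}\<close> takes equal values at \<open>x\<close> and
      \<open>y\<close>, against its injectivity.\<close>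
    then have "{x, partner x} = {y, partner y}"
      using gx gy by (metis insertI1)
    then show False
      using gx eqs \<open>x \<noteq> y\<close> by (metis inj_onD insertI1)
  qed
  moreover have "F ` (A - D) \<subseteq> D \<inter> B"
    using F(1,2) adj_A by blast
  moreover have fin: "finite D"
    using D finite_verts finite_subset unfolding dominating_set_def by blast
  ultimately have "card (A - D) \<le> card (D \<inter> B)"
    by (meson card_inj_on_le finite_Int)
  moreover have "card A = card (A - D) + card (A \<inter> D)"
    using finite_A by (metis add.commute card_Int_Diff)
  moreover have "card D = card (D \<inter> B) + card (A \<inter> D)"
  proof -
    have "D = (D \<inter> B) \<union> (A \<inter> D)" "(D \<inter> B) \<inter> (A \<inter> D) = {}"
      using D_verts disjoint by auto
    then show ?thesis
      using fin by (metis card_Un_disjoint finite_Int)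
  qed
  ultimately show ?thesis
    by simp
qed

end

section \<open>The equivalences for connected bipartite graphs\<close>

theorem theorem5:
  fixes G :: "('a, 'b) pre_digraph" and A B :: "'a set"
  assumes "graph G"
    and "Digraph_Component.connected G"
    and "bipartition G A B"
    and "1 \<le> card A"
    and "card A \<le> card B"
  defines "P1 \<equiv> domination_number G = card A"
    and "P2 \<equiv> domination_number G = covering_number G \<and> covering_number G = card A"
    and "P3a \<equiv> \<forall>s \<in> supports G \<inter> B.
           s \<in> weak_supports G \<and> (\<forall>w \<in> neighbors G s - leaves G. w \<in> supports G)"
    and "P3b \<equiv> \<forall>x \<in> A - (leaves G \<union> supports G). \<forall>y \<in> A - (leaves G \<union> supports G).
           graph_dist G x y = 2 \<longrightarrow>
             (\<exists>x' \<in> B. \<exists>y' \<in> B. x' \<noteq> y' \<and> neighbors G x' = {x, y} \<and> neighbors G y' = {x, y})"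
  shows "(P1 \<longleftrightarrow> P2) \<and> (P2 \<longleftrightarrow> P3a \<and> P3b)"
proof -
  interpret graph G by fact
  have disj: "A \<inter> B = {}" and verts: "verts G = A \<union> B"
    using assms(3) by (auto simp: bipartition_def)
  obtain a b where "a \<in> A" "b \<in> B"
    using assms(4,5) by (metis card.empty ex_in_conv le_trans not_one_le_zero)
  then have ab: "a \<in> verts G" "b \<in> verts G" "a \<noteq> b"
    using verts disj by auto
  \<comment> \<open>A second vertex to connect to is \<open>b\<close> for \<open>a\<close>, and
    \<open>a\<close> for all others.\<close>
  have no_isolated: "\<exists>w. v \<rightarrow>\<^bsub>G\<^esub> w" if "v \<in> verts G" for v
  proof (cases "v = a")
    case True
    then show ?thesis
      using connected_has_neighbor[OF assms(2) ab] by metis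
  next
    case False
    then show ?thesis
      using connected_has_neighbor[OF assms(2) that ab(1)] by metis
  qed
  interpret bipartite_graph G A B
    using assms(3) no_isolated by unfold_locales
  have P12: "P1 \<longleftrightarrow> P2"
    unfolding P1_def P2_def by (rule domination_eq_iff_domination_covering_eq)
  \<comment> \<open>Vertices of \<open>A\<close> are never adjacent, so distance two just means
    distinct with a common neighbor.\<close>
  have dist2: "graph_dist G x y = 2 \<longleftrightarrow> x \<noteq> y \<and> (\<exists>z. x \<rightarrow>\<^bsub>G\<^esub> z \<and> z \<rightarrow>\<^bsub>G\<^esub> y)" if "x \<in> A" "y \<in> A" for x y
  proof -
    have "\<not> x \<rightarrow>\<^bsub>G\<^esub> y"
      using that adj_A disjoint by blast
    then show ?thesis
      unfolding graph_dist_eq_2_iff by simp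
  qed
  have "P3a \<and> P3b" if P1
  proof
    show P3a
      unfolding P3a_def
    proof (intro ballI conjI)
      fix s
      assume s: "s \<in> supports G \<inter> B"
      show "s \<in> weak_supports G"
        using support_in_B_weak[of s] that s unfolding P1_def by simp
      show "w \<in> supports G" if "w \<in> neighbors G s - leaves G" for w
        using support_in_B_neighbor[of s w] \<open>P1\<close> that s unfolding P1_def by simp
    qed
    show P3b
      unfolding P3b_def
    proof (intro ballI impI)
      fix x y
      assume x: "x \<in> A - (leaves G \<union> supports G)" and y: "y \<in> A - (leaves G \<union> supports G)"
        and "graph_dist G x y = 2"
      then obtain z where "x \<noteq> y" "z \<rightarrow>\<^bsub>G\<^esub> x" "z \<rightarrow>\<^bsub>G\<^esub> y"
        using dist2 adj_sym by blast
      then show "\<exists>x' \<in> B. \<exists>y' \<in> B. x' \<noteq> y' \<and> neighbors G x' = {x, y} \<and> neighbors G y' = {x, y}"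
        using two_private_common_neighbors[of x y z] that x y unfolding P1_def by blast
    qed
  qed
  moreover have P1 if 3: "P3a \<and> P3b"
  proof -
    obtain D where D: "dominating_set G D" "card D = domination_number G"
      by (rule domination_numberE)
    have "card A \<le> card D"
    proof (rule card_A_le_dominating[OF _ _ D(1)])
      show "s \<in> weak_supports G \<and> (\<forall>w \<in> neighbors G s - leaves G. w \<in> supports G)"
        if "s \<in> supports G" "s \<in> B" for s
        using 3 that unfolding P3a_def by blast
      show "\<exists>x' \<in> B. \<exists>y' \<in> B. x' \<noteq> y' \<and> neighbors G x' = {x, y} \<and> neighbors G y' = {x, y}"
        if "x \<in> A - (leaves G \<union> supports G)" "y \<in> A - (leaves G \<union> supports G)"
          "x \<noteq> y" "x \<rightarrow>\<^bsub>G\<^esub> z" "z \<rightarrow>\<^bsub>G\<^esub> y" for x y z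
        using 3 that dist2[of x y] unfolding P3b_def by blast
    qed
    \<comment> \<open>The reverse inequality holds because \<open>A\<close> covers and hence
      dominates.\<close>
    then show P1
      using D domination_number_le[OF covering_imp_dominating[OF covering_A]]
      unfolding P1_def by simp
  qed
  ultimately show ?thesis
    using P12 by blast
qed

end
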